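(* Let $p/q\in\mathbb Q\setminus\mathbb Z$ be a rational number in lowest terms, with continued fraction expansion $\mathcal C_1=[a_0;\mathbf a]=[a_0;a_1,\dots,a_{2k}]$ taken with last partial quotient of even index $2k$, and let $(x_n)_{n\ge1}$ be the integer sequence defined by $$x_1=q,\qquad x_{j+1}=x_j^2z_{j+1},\quad j\ge1,$$ where $(z_n)_{n\ge2}$ is an arbitrary sequence of positive integers, subject to the restriction $z_j\ge2$ for all $j\ge2$. With the transformations $\varphi_z$ and $\varphi_z^*$ defined in the context, define a sequence of finite continued fractions by $$\mathcal C_2=\begin{cases}\varphi^*_{z_2}(\mathcal C_1),&\text{if } a_{2k}=1,\\ \varphi_{z_2}(\mathcal C_1),&\text{otherwise,}\end{cases}$$ and, for all $j\ge2$, $$\mathcal C_{j+1}=\begin{cases}\varphi^*_{z_{j+1}}(\mathcal C_j),&\text{if } a_1=1,\\ \varphi_{z_{j+1}}(\mathcal C_j),&\text{otherwise.}\end{cases}$$ Then the modified Engel series $$\alpha=\frac pq+\sum_{j=2}^\infty\frac1{x_j}$$ has continued fraction expansion $\lim_{N\to\infty}\mathcal C_N$.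
   Context: $[a_0;a_1,\dots,a_n]$ denotes the finite continued fraction $a_0+\cfrac1{a_1+\cfrac1{\cdots+\cfrac1{a_n}}}$ with $a_0\in\mathbb Z$ and $a_j\in\mathbb Z_{>0}$ for $j\ge1$. Every rational number has such an expansion whose last index is even, since $[a_0;\dots,a_j]=[a_0;\dots,a_j-1,1]$ if $j=0$ or $a_j>1$, and $[a_0;\dots,a_{j-1},1]=[a_0;\dots,a_{j-1}+1]$. For $n\ge2$, a finite continued fraction $[a_0;\mathbf a]$ with $\mathbf a=(a_1,\dots,a_n)$, and a positive integer $z$, define $$\varphi_z([a_0;\mathbf a])=[a_0;\mathbf a,z-1,\hat{\mathbf a}],\qquad \hat{\mathbf a}=(1,a_n-1,a_{n-1},\dots,a_2,a_1),$$ $$\varphi_z^*([a_0;\mathbf a])=[a_0;\mathbf a,z-1,\mathbf a^*],\qquad \mathbf a^*=(a_{n-1}+1,a_{n-2},\dots,a_2,a_1)$$ (for $n=2$, $\mathbf a^*=(a_1+1)$). Commas denote concatenation of words. The transformation $\varphi_z^*$ is the result of applying $\varphi_z$ to a continued fraction with $a_n=1$ and then removing the resulting zero by the rule $[\dots,A,0,B,\dots]\to[\dots,A+B,\dots]$. The list of partial quotients of $\mathcal C_N$ is an initial segment of that of $\mathcal C_{N+1}$; $\lim_{N\to\infty}\mathcal C_N$ is the infinite continued fraction whose partial quotients extend those of every $\mathcal C_N$.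
   Formalization: For q=2 the printed rule fails: C_1=[a_0;1,1] gives C_2=[a_0;1,1,z_2-1,2], not ending in 1, so φ* gives a wrong C_3; here C_3=φ_{z_3}(C_2) is used when q=2, all else as printed. *)

theory Defs
  imports Complex_Main
begin

text \<open>A finite continued fraction $[a_0; a_1, \ldots, a_n]$ is represented by the list of all its
  partial quotients, including $a_0$; its last index $n$ is therefore one less than the length of
  the list, and $a_j$ is the list element at position $j$.\<close>

definition cf_wf :: "int list \<Rightarrow> bool" where
  "cf_wf c \<longleftrightarrow> c \<noteq> [] \<and> (\<forall>a \<in> set (tl c). a > 0)"

fun cf_value :: "int list \<Rightarrow> real" where
  "cf_value [] = 0"
| "cf_value [a] = of_int a"
| "cf_value (a # b # c) = of_int a + 1 / cf_value (b # c)"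

text \<open>The words $\hat{\mathbf a} = (1, a_n - 1, a_{n-1}, \ldots, a_1)$ and
  $\mathbf a^* = (a_{n-1} + 1, a_{n-2}, \ldots, a_1)$ of a word $\mathbf a = (a_1, \ldots, a_n)$,
  meaningful for $n \ge 2$. For $n = 2$ the word $\mathbf a^*$ is $(a_1 + 1)$, so that it does not
  end in $a_1$, unlike in all other cases. Starting from $[a_0; 1, 1] = a_0 + 1/2$, one application of
  $\varphi^*_z$ thus gives $[a_0; 1, 1, z - 1, 2]$, to which $\varphi$ and not $\varphi^*$ has to
  be applied next even though $a_1 = 1$.\<close>

definition hat_word :: "int list \<Rightarrow> int list" where
  "hat_word a = 1 # (last a - 1) # rev (butlast a)"

definition star_word :: "int list \<Rightarrow> int list" where
  "star_word a = (case rev (butlast a) of [] \<Rightarrow> [] | b # bs \<Rightarrow> (b + 1) # bs)"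

definition cf_phi :: "int \<Rightarrow> int list \<Rightarrow> int list" where
  "cf_phi z c = c @ [z - 1] @ hat_word (tl c)"

definition cf_phi_star :: "int \<Rightarrow> int list \<Rightarrow> int list" where
  "cf_phi_star z c = c @ [z - 1] @ star_word (tl c)"

text \<open>The infinite continued fraction with partial quotients \<open>b 0, b 1, b 2, \<dots>\<close> is the limit of
  the sequence \<open>C 1, C 2, \<dots>\<close> of finite ones (\<open>C 0\<close> is ignored). The growth of the
  lengths makes \<open>b\<close> unique.\<close>

definition is_cf_limit :: "(nat \<Rightarrow> int list) \<Rightarrow> (nat \<Rightarrow> int) \<Rightarrow> bool" where
  "is_cf_limit C b \<longleftrightarrow>
     (\<forall>N\<ge>1. C N = map b [0..<length (C N)]) \<and>
     filterlim (\<lambda>N. length (C N)) at_top sequentially"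

definition has_cf_expansion :: "real \<Rightarrow> (nat \<Rightarrow> int) \<Rightarrow> bool" where
  "has_cf_expansion \<alpha> b \<longleftrightarrow>
     (\<forall>j\<ge>1. b j > 0) \<and> (\<lambda>n. cf_value (map b [0..<Suc n])) \<longlonglongrightarrow> \<alpha>"

end

theory Submission
  imports Defs
begin

text \<open>For $c = [a_0; \mathbf a]$ with $\mathbf a = (a_1, \ldots, a_n)$ and $n$ even, let $P/Q$ and
  $P'/Q'$ be the last two convergents, so that $P Q' - P' Q = -1$. By the symmetry of continuants,
  the word $w = \hat{\mathbf a}$ (or $w = \mathbf a^*$ if $a_n = 1$) has continuant $Q$, and removing
  its first letter leaves continuant $Q - Q'$. Hence $(z - 1, w)$ has continuant $z Q - Q'$, and the
  extended continued fraction is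
  $(P (z Q - Q') + P' Q) / (Q (z Q - Q') + Q' Q) = (z P Q + 1) / (z Q^2) = P/Q + 1/(z Q^2)$, with
  denominator exactly $z Q^2$. So $\mathcal C_N$ has denominator $x_N$ and its value is the
  $N$-th partial sum of the series; all later convergents differ from it by at most $1/x_N^2$.\<close>

section \<open>Continuants and their classical identities\<close>

fun continuant :: "int list \<Rightarrow> int" where
  "continuant [] = 1"
| "continuant [a] = a"
| "continuant (a # b # c) = a * continuant (b # c) + continuant c"

lemma continuant_Cons: "w \<noteq> [] \<Longrightarrow> continuant (a # w) = a * continuant w + continuant (tl w)"
  by (cases w) auto

text \<open>A continuant sums the products left after deleting disjoint pairs of neighbouring
  letters. The second term collects the deletions of the pair at the seam, the last letter of
  \<open>c\<close> and \<open>b\<close>.\<close>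

lemma continuant_append:
  assumes "c \<noteq> []"
  shows "continuant (c @ b # d) =
    continuant c * continuant (b # d) + continuant (butlast c) * continuant d"
  using assms
proof (induction c rule: continuant.induct)
  case (3 a e c)
  then show ?case
    by (cases c) (auto simp: algebra_simps)
qed auto

text \<open>The append rule with a one-letter second word expands a continuant from its right end,
  mirroring the defining expansion from the left. Both \<open>e\<close> and \<open>butlast e\<close>
  enter, hence the induction on the length.\<close>

lemma continuant_rev: "continuant (rev c) = continuant c"
proof (induction "length c" arbitrary: c rule: less_induct)
  case less
  show ?case
  proof (cases c rule: rev_cases)
    case (snoc e a)
    have e: "continuant (rev e) = continuant e"
      "continuant (rev (butlast e)) = continuant (butlast e)"
      using less snoc by auto
    have "tl (rev e) = rev (butlast e)"
      by (cases e rule: rev_cases) auto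
    then show ?thesis
      using snoc e continuant_Cons[of "rev e" a] continuant_append[of e a "[]"]
      by (cases "e = []") (auto simp: mult.commute)
  qed auto
qed

text \<open>This is the determinant of the last two convergents. Expanding at the first letter
  \<open>a\<close>, the multiples of \<open>a\<close> cancel and the determinant of the tail remains
  with opposite sign.\<close>

lemma continuant_det:
  assumes "length c \<ge> 2"
  shows "continuant c * continuant (tl (butlast c)) - continuant (butlast c) * continuant (tl c) =
    (-1) ^ length c"
  using assms
proof (induction c rule: continuant.induct)
  case (3 a b c)
  show ?case
  proof (cases c)
    case (Cons e d)
    have "continuant (b # c) * continuant (tl (butlast (b # c))) -
        continuant (butlast (b # c)) * continuant c = (-1) ^ length (b # c)"
      using "3.IH" Cons by simp
    then show ?thesis
      using Cons continuant_Cons[of "b # c" a] continuant_Cons[of "butlast (b # c)" a]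
      by (simp add: algebra_simps)
  qed auto
qed auto

lemma continuant_pos: "\<forall>a \<in> set c. a > 0 \<Longrightarrow> continuant c > 0"
  by (induction c rule: continuant.induct) (auto intro!: add_pos_pos mult_pos_pos)

section \<open>Values and denominators of finite continued fractions\<close>

lemma continuant_tl_pos: "cf_wf c \<Longrightarrow> continuant (tl c) > 0"
  by (simp add: cf_wf_def continuant_pos)

lemma cf_value_eq_continuants:
  "cf_wf c \<Longrightarrow> cf_value c = of_int (continuant c) / of_int (continuant (tl c))"
proof (induction c rule: cf_value.induct)
  case (3 a b c)
  then have "continuant (b # c) > 0" "cf_wf (b # c)"
    using continuant_tl_pos[of "a # b # c"] by (auto simp: cf_wf_def)
  then show ?case
    using 3 by (simp add: field_simps)
qed (auto simp: cf_wf_def)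

lemma cf_wf_append: "c \<noteq> [] \<Longrightarrow> cf_wf (c @ d) \<longleftrightarrow> cf_wf c \<and> (\<forall>a \<in> set d. a > 0)"
  by (auto simp: cf_wf_def)

text \<open>Appending a nonempty \<open>d\<close> turns the value \<open>P / Q\<close> into
  \<open>(P * U + P' * V) / (Q * U + Q' * V)\<close>, where \<open>U / V\<close> is the value of
  \<open>d\<close>. The determinant makes the distance \<open>V / ((Q * U + Q' * V) * Q)\<close>,
  and \<open>U >= V\<close> because the first letter of \<open>d\<close> is at least 1.\<close>

lemma cf_value_append_dist:
  assumes wf: "cf_wf (c @ d)" and len: "length c \<ge> 2"
  shows "\<bar>cf_value (c @ d) - cf_value c\<bar> \<le> 1 / of_int (continuant (tl c)) ^ 2"
proof (cases d)
  case (Cons b e)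
  have ne: "c \<noteq> []" "tl c \<noteq> []" "butlast (tl c) = tl (butlast c)"
    using len by (auto simp: butlast_tl simp flip: length_greater_0_conv)
  have wfc: "cf_wf c" and pos: "\<forall>a \<in> set (b # e). a > 0"
    using wf Cons ne by (auto simp: cf_wf_append)
  define P Q P' Q' U V where defs: "P = real_of_int (continuant c)"
    "Q = real_of_int (continuant (tl c))" "P' = real_of_int (continuant (butlast c))"
    "Q' = real_of_int (continuant (tl (butlast c)))"
    "U = real_of_int (continuant (b # e))" "V = real_of_int (continuant e)"
  have "continuant e > 0"
    using pos by (auto intro: continuant_pos)
  moreover have "continuant (b # e) \<ge> continuant e"
  proof (cases "e = []")
    case False
    have "continuant (tl e) > 0"
      using pos by (auto intro!: continuant_pos dest: list.set_sel(2)[OF False])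
    moreover have "b * continuant e \<ge> 1 * continuant e"
      using pos \<open>continuant e > 0\<close> by (intro mult_right_mono) auto
    ultimately show ?thesis
      using continuant_Cons[OF False, of b] by simp
  qed (use pos in auto)
  ultimately have V: "V > 0" "U \<ge> V"
    by (auto simp: defs)
  have Q: "Q > 0"
    using continuant_tl_pos[OF wfc] by (simp add: defs)
  have "\<forall>a \<in> set (butlast (tl c)). a > 0"
    using wfc by (auto simp: cf_wf_def dest: in_set_butlastD)
  then have Q': "Q' > 0"
    using ne continuant_pos by (simp add: defs)
  have det: "\<bar>P * Q' - P' * Q\<bar> = 1"
  proof -
    have "P * Q' - P' * Q = (-1) ^ length c"
      using arg_cong[OF continuant_det[OF len], of real_of_int] by (simp add: defs)
    then show ?thesis
      by (simp add: power_abs)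
  qed
  have cd: "cf_value (c @ d) = (P * U + P' * V) / (Q * U + Q' * V)"
    using cf_value_eq_continuants[OF wf] ne Cons
    by (simp add: continuant_append defs)
  have c: "cf_value c = P / Q"
    using cf_value_eq_continuants[OF wfc] by (simp add: defs)
  have D: "Q * U + Q' * V > 0"
    using Q Q' V by (intro add_pos_pos mult_pos_pos) auto
  have "cf_value (c @ d) - cf_value c = - (P * Q' - P' * Q) * V / ((Q * U + Q' * V) * Q)"
    unfolding cd c by (subst diff_frac_eq) (use Q D in \<open>auto simp: algebra_simps\<close>)
  then have "\<bar>cf_value (c @ d) - cf_value c\<bar> = V / ((Q * U + Q' * V) * Q)"
    using det V Q D by (simp add: abs_mult)
  also have "\<dots> \<le> V / ((Q * V) * Q)"
    using V Q Q' by (intro divide_left_mono mult_right_mono mult_pos_pos D) (auto intro: add_increasing2)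
  also have "\<dots> = 1 / Q ^ 2"
    using V by (simp add: power2_eq_square)
  finally show ?thesis
    by (simp add: defs)
qed auto

text \<open>The determinant identity shows that the quotient of the two continuants is in lowest
  terms, and a reduced fraction with positive denominator is unique. This ties x_1 = q to the list
  C_1.\<close>

lemma cf_value_integer_denominator:
  assumes "cf_wf c" "length c \<ge> 2" "cf_value c = real_of_int p / real_of_int q" "coprime p q" "q > 0"
  shows "continuant (tl c) = q"
proof -
  have Q: "continuant (tl c) > 0"
    using assms by (simp add: continuant_tl_pos)
  have "coprime (continuant c) (continuant (tl c))"
  proof (rule coprimeI)
    fix l assume "l dvd continuant c" "l dvd continuant (tl c)"
    then have "l dvd (-1) ^ length c"
      unfolding continuant_det[OF assms(2), symmetric] by (intro dvd_diff) auto
    then show "is_unit l"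
      by (meson dvd_trans is_unit_power_iff dvd_refl minus_dvd_iff)
  qed
  moreover have "real_of_int (continuant c * q) = real_of_int (p * continuant (tl c))"
    using cf_value_eq_continuants[OF assms(1)] assms(3,5) Q by (simp add: field_simps)
  then have "continuant c * q = p * continuant (tl c)"
    by linarith
  ultimately show ?thesis
    using \<open>coprime p q\<close> \<open>q > 0\<close> Q
    by (metis coprime_commute coprime_dvd_mult_right_iff dvd_triv_right mult.commute zdvd_antisym_nonneg
        order_less_imp_le)
qed

section \<open>Extension by a reflected word\<close>

text \<open>The hypotheses on \<open>w\<close> are what the hatted and the starred word have in
  common. Odd list length means even last index, so the determinant is -1 and leaves the summand 1
  in the numerator.\<close>

lemma continuant_extend:
  assumes len: "length c \<ge> 3" "odd (length c)"
    and w: "w \<noteq> []" "continuant w = continuant (tl c)"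
      "continuant (tl w) = continuant (tl c) - continuant (butlast (tl c))"
  shows "continuant (c @ (z - 1) # w) = z * continuant c * continuant (tl c) + 1"
    and "continuant (tl (c @ (z - 1) # w)) = z * continuant (tl c) ^ 2"
proof -
  have ne: "c \<noteq> []" "tl c \<noteq> []"
    using len by (auto simp flip: length_greater_0_conv)
  \<comment> \<open>With Q and Q' the continuants of \<open>tl c\<close> and
    \<open>butlast (tl c)\<close>, this is (z - 1) Q + (Q - Q').\<close>
  have zw: "continuant ((z - 1) # w) = z * continuant (tl c) - continuant (butlast (tl c))"
    using w by (simp add: continuant_Cons algebra_simps)
  have det: "continuant c * continuant (butlast (tl c)) =
      continuant (butlast c) * continuant (tl c) - 1"
    using continuant_det[of c] len by (simp add: butlast_tl)
  show "continuant (c @ (z - 1) # w) = z * continuant c * continuant (tl c) + 1"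
    unfolding continuant_append[OF ne(1)] zw w(2) right_diff_distrib det by simp
  show "continuant (tl (c @ (z - 1) # w)) = z * continuant (tl c) ^ 2"
    using ne by (simp add: continuant_append zw w(2) algebra_simps power2_eq_square)
qed

text \<open>Splitting the first letter of \<open>rev a\<close> into 1 and \<open>last a - 1\<close>
  preserves the continuant, as 1 ((m - 1) K + K') + K = m K + K'. Dropping the 1 loses exactly K,
  the continuant of \<open>butlast a\<close>.\<close>

lemma hat_word_continuants:
  assumes "length a \<ge> 2"
  shows "continuant (hat_word a) = continuant a"
    and "continuant (tl (hat_word a)) = continuant a - continuant (butlast a)"
proof -
  have ne: "a \<noteq> []" "butlast a \<noteq> []"
    using assms by (auto simp flip: length_greater_0_conv)
  have ra: "rev a = last a # rev (butlast a)"
    using ne by (metis append_butlast_last_id rev_rev_ident rev.simps(2))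
  have "continuant a = last a * continuant (rev (butlast a)) + continuant (tl (rev (butlast a)))"
    using continuant_rev[of a] continuant_Cons[of "rev (butlast a)" "last a"] ne unfolding ra by simp
  then show "continuant (hat_word a) = continuant a"
    "continuant (tl (hat_word a)) = continuant a - continuant (butlast a)"
    using ne continuant_rev[of "butlast a"] by (auto simp: hat_word_def continuant_Cons algebra_simps)
qed

text \<open>Here \<open>rev a\<close> is \<open>1 # b # bs\<close>, and merging the 1 into
  \<open>b\<close> preserves the continuant: both sides are the sum of those of
  \<open>b # bs\<close> and \<open>bs\<close>.\<close>

lemma star_word_continuants:
  assumes "length a \<ge> 2" "last a = 1"
  shows "continuant (star_word a) = continuant a"
    and "continuant (tl (star_word a)) = continuant a - continuant (butlast a)"
proof -
  have ne: "a \<noteq> []" "butlast a \<noteq> []"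
    using assms by (auto simp flip: length_greater_0_conv)
  obtain b bs where r: "rev (butlast a) = b # bs"
    using ne by (cases "rev (butlast a)") auto
  have "rev a = last a # rev (butlast a)"
    using ne by (metis append_butlast_last_id rev_rev_ident rev.simps(2))
  then have a: "continuant a = continuant (b # bs) + continuant bs"
    using continuant_rev[of a] assms r by (simp add: continuant_Cons)
  show "continuant (star_word a) = continuant a"
    using a r by (cases bs) (auto simp: star_word_def algebra_simps)
  show "continuant (tl (star_word a)) = continuant a - continuant (butlast a)"
    using a r continuant_rev[of "butlast a"] by (simp add: star_word_def)
qed

lemma length_star_word: "length (star_word a) = length a - 1"
  by (cases a rule: rev_cases) (auto simp: star_word_def split: list.split)

section \<open>One step of the recursion\<close>

text \<open>The flag separates the choice of rule from its test: the recursion tests the last letter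
  of C_1 first and a_1 afterwards, whereas correctness depends on the current last letter.\<close>

definition cf_step :: "bool \<Rightarrow> int \<Rightarrow> int list \<Rightarrow> int list" where
  "cf_step s z c = (if s then cf_phi_star z c else cf_phi z c)"

lemma cf_step_prefix: "\<exists>d. d \<noteq> [] \<and> cf_step s z c = c @ d"
  by (auto simp: cf_step_def cf_phi_def cf_phi_star_def)

text \<open>The flag has to match the last letter: \<open>hat_word\<close> contains
  \<open>last c - 1\<close>, which must stay positive, while the continuant identities for
  \<open>star_word\<close> rely on \<open>last c = 1\<close>. The bound on \<open>z\<close> keeps
  \<open>z - 1\<close> positive.\<close>

lemma cf_step_correct:
  assumes wf: "cf_wf c" and len: "length c \<ge> 3" "odd (length c)" and z: "z \<ge> 2"
    and s: "s \<longleftrightarrow> last c = 1"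
  shows "cf_wf (cf_step s z c)" "odd (length (cf_step s z c))" "length (cf_step s z c) \<ge> 5"
    and "continuant (tl (cf_step s z c)) = continuant (tl c) ^ 2 * z"
    and "cf_value (cf_step s z c) = cf_value c + 1 / of_int (continuant (tl c) ^ 2 * z)"
proof -
  define w where "w = (if s then star_word (tl c) else hat_word (tl c))"
  have step: "cf_step s z c = c @ (z - 1) # w"
    by (simp add: cf_step_def w_def cf_phi_def cf_phi_star_def)
  have ne: "c \<noteq> []" "tl c \<noteq> []" and last: "last (tl c) = last c"
    using len by (auto simp: last_tl simp flip: length_greater_0_conv)
  have pos: "\<forall>a \<in> set (tl c). a > 0"
    using wf by (simp add: cf_wf_def)
  then have posb: "\<forall>a \<in> set (rev (butlast (tl c))). a > 0"
    by (auto dest: in_set_butlastD)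
  have "last c > 0"
    using pos ne last by (metis last_in_set)
  then have lastc: "\<not> s \<Longrightarrow> last c > 1"
    using s by linarith
  \<comment> \<open>The new length is therefore 2 n - 1 or 2 n + 1 with n = \<open>length c\<close>,
    which is odd and at least 5.\<close>
  have lenw: "length w = (if s then length c - 2 else length c)"
    using len by (auto simp: w_def length_star_word hat_word_def)
  have w: "w \<noteq> []" "continuant w = continuant (tl c)"
    "continuant (tl w) = continuant (tl c) - continuant (butlast (tl c))"
    using star_word_continuants[of "tl c"] hat_word_continuants[of "tl c"] len s last lenw
    by (auto simp: w_def)
  have posw: "\<forall>a \<in> set w. a > 0"
  proof (cases "rev (butlast (tl c))")
    case Nil
    then show ?thesis
      using lastc last by (auto simp: w_def star_word_def hat_word_def)
  next
    case (Cons b bs)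
    then show ?thesis
      using posb lastc last unfolding w_def star_word_def hat_word_def Cons by auto
  qed
  show wf': "cf_wf (cf_step s z c)"
    using wf posw z ne by (simp add: step cf_wf_append)
  show "odd (length (cf_step s z c))" "length (cf_step s z c) \<ge> 5"
    using len lenw by (auto simp: step)
  note ext = continuant_extend[OF len w, of z]
  show "continuant (tl (cf_step s z c)) = continuant (tl c) ^ 2 * z"
    by (simp add: step ext(2))
  have "real_of_int (continuant (tl c)) > 0" "real_of_int z > 0"
    using continuant_tl_pos[OF wf] z by auto
  then show "cf_value (cf_step s z c) = cf_value c + 1 / of_int (continuant (tl c) ^ 2 * z)"
    unfolding cf_value_eq_continuants[OF wf'] cf_value_eq_continuants[OF wf]
    unfolding step ext by (simp add: field_simps power2_eq_square)
qed

lemma cf_step_nth_1: "length c \<ge> 2 \<Longrightarrow> cf_step s z c ! 1 = c ! 1"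
  by (auto simp: cf_step_def cf_phi_def cf_phi_star_def nth_append)

text \<open>Both appended words run backwards to a_1, except that for length 3 the starred word is
  the single letter a_1 + 1. Outside this case, testing a_1 = 1 amounts to testing the new last
  letter.\<close>

lemma last_cf_step:
  assumes "length c \<ge> 3"
  shows "last (cf_step s z c) = (if s \<and> length c = 3 then c ! 1 + 1 else c ! 1)"
proof -
  obtain a0 a1 a2 d where c: "c = a0 # a1 # a2 # d"
    using assms by (metis Suc_le_length_iff numeral_3_eq_3)
  show ?thesis
    by (cases d rule: rev_cases)
       (auto simp: c cf_step_def cf_phi_def cf_phi_star_def hat_word_def star_word_def butlast_append
          split: list.splits, metis last_ConsR last_append last_ConsL list.distinct(1))
qed

text \<open>This justifies the exception \<open>j = 2\<close>, \<open>q = 2\<close> in the recursion: it is the only case with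
  $a_1 = 1$ in which $\mathcal C_2$ does not end in 1.\<close>

lemma cf_denominator_2_iff:
  assumes wf: "cf_wf c" and len: "length c \<ge> 3" and 1: "c ! 1 = 1"
  shows "continuant (tl c) = 2 \<longleftrightarrow> length c = 3 \<and> last c = 1"
proof -
  obtain a0 a2 d where c: "c = a0 # 1 # a2 # d"
    using len 1 by (metis Suc_le_length_iff numeral_3_eq_3 nth_Cons_0 nth_Cons_Suc One_nat_def)
  have pos: "a2 > 0" "\<forall>a \<in> set d. a > 0"
    using wf by (auto simp: cf_wf_def c)
  have d: "continuant d > 0"
    using pos by (simp add: continuant_pos)
  \<comment> \<open>For length 3 the denominator is \<open>a2 + 1\<close>, which is 2 exactly when
    \<open>a2 = 1\<close>. With further letters it is
    \<open>(a2 + 1) * continuant d + continuant e\<close>, at least 3.\<close>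
  show ?thesis
  proof (cases d)
    case (Cons b e)
    have "continuant e > 0"
      using pos Cons by (auto intro: continuant_pos)
    moreover have "a2 * continuant d \<ge> 1 * continuant d"
      using pos d by (intro mult_right_mono) auto
    moreover have "continuant (tl c) = a2 * continuant d + continuant e + continuant d"
      by (simp add: c Cons)
    ultimately have "continuant (tl c) > 2"
      using d by linarith
    then show ?thesis
      using Cons by (simp add: c)
  qed (auto simp: c)
qed

section \<open>Passage to the infinite continued fraction\<close>

lemma cf_limit_exists:
  assumes prefix: "\<And>N. N \<ge> 1 \<Longrightarrow> \<exists>d. d \<noteq> [] \<and> C (Suc N) = C N @ d"
  shows "\<exists>b. is_cf_limit C b"
proof -
  have prefix_le: "\<exists>d. C (N + i) = C N @ d" if "N \<ge> 1" for N i
  proof (induction i)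
    case (Suc i)
    then show ?case
      using prefix[of "N + i"] that by auto
  qed auto
  have len: "length (C (Suc n)) \<ge> n" for n
  proof (induction n)
    case (Suc n)
    then show ?case
      using prefix[of "Suc n"] by (auto simp flip: length_greater_0_conv)
  qed auto
  \<comment> \<open>By \<open>len\<close>, the list \<open>C (n + 2)\<close> has at least
    \<open>n + 1\<close> letters, so position \<open>n\<close> exists in it; every later list agrees
    with it there.\<close>
  define b where "b n = C (n + 2) ! n" for n
  have "C N ! n = b n" if "N \<ge> 1" "n < length (C N)" for N n
  proof -
    obtain d where "C (N + (n + 2)) = C N @ d"
      using prefix_le \<open>N \<ge> 1\<close> by blast
    moreover obtain e where "C (n + 2 + N) = C (n + 2) @ e"
      using prefix_le[of "n + 2" N] by auto
    moreover have "n < length (C (n + 2))"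
      using len[of "Suc n"] by simp
    ultimately show ?thesis
      using that by (metis b_def add.commute nth_append)
  qed
  then have "\<forall>N\<ge>1. C N = map b [0..<length (C N)]"
    by (auto intro: nth_equalityI)
  moreover have "filterlim (\<lambda>N. length (C N)) at_top sequentially"
    by (rule filterlim_sequentially_Suc[THEN iffD1], rule filterlim_at_top_mono[OF filterlim_ident])
       (use len in auto)
  ultimately show ?thesis
    by (auto simp: is_cf_limit_def)
qed

text \<open>Convergence along the lists \<open>C N\<close> extends to all convergents: each later
  one arises by appending letters to \<open>C N\<close>, so it differs from its value by at most the
  inverse square of the denominator, which tends to 0.\<close>

lemma cf_limit_expansion:
  assumes lim: "is_cf_limit C b"
    and wf: "\<And>N. N \<ge> 1 \<Longrightarrow> cf_wf (C N)"
    and len: "\<And>N. N \<ge> 1 \<Longrightarrow> length (C N) \<ge> 2"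
    and den: "filterlim (\<lambda>N. real_of_int (continuant (tl (C N)))) at_top sequentially"
    and val: "(\<lambda>N. cf_value (C N)) \<longlonglongrightarrow> \<alpha>"
  shows "has_cf_expansion \<alpha> b"
proof -
  have C: "C N = map b [0..<length (C N)]" if "N \<ge> 1" for N
    using lim that by (auto simp: is_cf_limit_def)
  have large: "\<exists>N\<ge>1. length (C N) \<ge> n" for n
  proof -
    have "eventually (\<lambda>N. length (C N) \<ge> n \<and> N \<ge> 1) sequentially"
      using lim by (auto simp: is_cf_limit_def filterlim_at_top intro: eventually_conj eventually_ge_at_top)
    then show ?thesis
      by (auto simp: eventually_sequentially)
  qed
  have pos: "b j > 0" if "j \<ge> 1" for j
  proof -
    obtain N where N: "N \<ge> 1" "length (C N) \<ge> Suc j"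
      using large by blast
    have "tl (C N) ! (j - 1) = b j"
      using C[OF N(1)] N that by (metis Suc_diff_1 Suc_le_eq add_0 diff_Suc_1 diff_less_mono
          length_tl less_le_trans nth_map_upt nth_tl zero_less_one diff_zero)
    moreover have "j - 1 < length (tl (C N))"
      using N that by auto
    ultimately show ?thesis
      using wf[OF N(1)] unfolding cf_wf_def by (metis nth_mem)
  qed
  have wfb: "cf_wf (map b [0..<Suc n])" for n
    by (auto simp: cf_wf_def pos simp flip: map_tl simp del: upt_Suc)
  have "(\<lambda>n. cf_value (map b [0..<Suc n])) \<longlonglongrightarrow> \<alpha>"
  proof (rule tendstoI)
    fix e :: real assume "e > 0"
    have "(\<lambda>N. 1 / real_of_int (continuant (tl (C N))) ^ 2) \<longlonglongrightarrow> 0"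
      by (intro tendsto_divide_0[OF tendsto_const] filterlim_at_top_imp_at_infinity
          filterlim_pow_at_top den) auto
    then have "\<forall>\<^sub>F N in sequentially. 1 / real_of_int (continuant (tl (C N))) ^ 2 < e / 2"
      using \<open>e > 0\<close> by (intro order_tendstoD) auto
    moreover have "\<forall>\<^sub>F N in sequentially. dist (cf_value (C N)) \<alpha> < e / 2"
      using val \<open>e > 0\<close> by (intro tendstoD) auto
    moreover have "\<forall>\<^sub>F N in sequentially. N \<ge> (1::nat)"
      by (rule eventually_ge_at_top)
    ultimately have "\<forall>\<^sub>F N in sequentially. 1 / real_of_int (continuant (tl (C N))) ^ 2 < e / 2 \<and>
        dist (cf_value (C N)) \<alpha> < e / 2 \<and> N \<ge> 1"
      by eventually_elim auto
    then obtain N where N: "1 / real_of_int (continuant (tl (C N))) ^ 2 < e / 2"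
      "dist (cf_value (C N)) \<alpha> < e / 2" "N \<ge> 1"
      by (auto simp: eventually_sequentially)
    have "dist (cf_value (map b [0..<Suc n])) \<alpha> < e" if "n \<ge> length (C N)" for n
    proof -
      have "[0..<Suc n] = [0..<length (C N)] @ [length (C N)..<Suc n]"
        using that by (metis le_Suc_eq le_add_diff_inverse upt_add_eq_append zero_le)
      then have eq: "map b [0..<Suc n] = C N @ map b [length (C N)..<Suc n]"
        using C[OF N(3)] by (metis map_append)
      have "\<bar>cf_value (map b [0..<Suc n]) - cf_value (C N)\<bar> \<le>
          1 / real_of_int (continuant (tl (C N))) ^ 2"
        unfolding eq by (rule cf_value_append_dist) (use wfb[of n] eq len N in auto)
      then show ?thesis
        using N unfolding dist_real_def by linarith
    qed
    then show "\<forall>\<^sub>F n in sequentially. dist (cf_value (map b [0..<Suc n])) \<alpha> < e"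
      by (auto simp: eventually_sequentially)
  qed
  with pos show ?thesis
    by (simp add: has_cf_expansion_def)
qed

section \<open>Application to the modified Engel series\<close>

theorem theorem4p2:
  fixes p q :: int and k :: nat and x z :: "nat \<Rightarrow> int" and C :: "nat \<Rightarrow> int list"
  assumes "q > 0" and "coprime p q" and "real_of_int p / real_of_int q \<notin> \<int>"
    and "cf_wf (C 1)" and "length (C 1) = 2 * k + 1"
    and "cf_value (C 1) = real_of_int p / real_of_int q"
    and "\<And>j. j \<ge> 2 \<Longrightarrow> z j \<ge> 2"
    and "x 1 = q" and "\<And>j. j \<ge> 1 \<Longrightarrow> x (j + 1) = (x j)\<^sup>2 * z (j + 1)"
    and "C 2 = (if C 1 ! (2 * k) = 1 then cf_phi_star (z 2) (C 1) else cf_phi (z 2) (C 1))"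
    and "\<And>j. j \<ge> 2 \<Longrightarrow> C (j + 1) =
           (if C 1 ! 1 = 1 \<and> \<not> (j = 2 \<and> q = 2)
            then cf_phi_star (z (j + 1)) (C j) else cf_phi (z (j + 1)) (C j))"
  shows "summable (\<lambda>j. 1 / real_of_int (x (j + 2))) \<and>
    (\<exists>b. is_cf_limit C b \<and>
         has_cf_expansion
           (real_of_int p / real_of_int q + (\<Sum>j. 1 / real_of_int (x (j + 2)))) b)"
proof -
  note q = assms(1) and wf1 = assms(4) and len1 = assms(5) and val1 = assms(6) and z = assms(7)
    and x1 = assms(8) and x_Suc = assms(9)
  \<comment> \<open>A one-letter list has an integer value, but p/q is not an integer. Hence C_1 has
    at least three letters.\<close>
  have "k \<noteq> 0"
  proof
    assume "k = 0"
    then obtain a where "C 1 = [a]"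
      using len1 by (auto simp: length_Suc_conv)
    then show False
      using val1 assms(3) by (metis Ints_of_int cf_value.simps(2))
  qed
  then have len1': "length (C 1) \<ge> 3" "odd (length (C 1))"
    using len1 by auto
  have last1: "C 1 ! (2 * k) = last (C 1)"
    using len1 by (subst last_conv_nth) auto
  have den1: "continuant (tl (C 1)) = q"
    using cf_value_integer_denominator[OF wf1 _ val1 assms(2) q] len1' by simp
  \<comment> \<open>This is the test that \<open>cf_step_correct\<close> demands;
    \<open>last2\<close> and \<open>inv\<close> show that the tests in the recursion agree with
    it.\<close>
  define s where "s j \<longleftrightarrow> last (C j) = 1" for j :: nat
  have C2: "C 2 = cf_step (s 1) (z 2) (C 1)"
    using assms(10) last1 by (simp add: cf_step_def s_def)
  \<comment> \<open>For a_1 = 1, the value q = 2 singles out C_1 = [a_0; 1, 1], whose extension ends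
    in 2. Positivity of a_1 excludes a_1 + 1 = 1, so the exceptional ending never equals 1.\<close>
  have last2: "s 2 \<longleftrightarrow> C 1 ! 1 = 1 \<and> q \<noteq> 2"
  proof -
    have "C 1 ! 1 > 0"
      using wf1 len1' unfolding cf_wf_def
      by (metis One_nat_def Suc_le_eq length_tl nth_mem nth_tl numeral_3_eq_3 zero_less_diff
          Suc_lessD)
    then show ?thesis
      using last_cf_step[of "C 1" "s 1" "z 2"] len1' cf_denominator_2_iff[OF wf1 len1'(1)] den1
      by (auto simp: s_def C2)
  qed
  \<comment> \<open>The induction starts at C_2, since the step from C_1 uses a different test.
    Length at least 5 rules out the exceptional ending from C_3 on, and the sum with
    \<open>Suc j\<close> terms ends in 1/x_{j+2}.\<close>
  have inv: "cf_wf (C (j + 2)) \<and> odd (length (C (j + 2))) \<and> length (C (j + 2)) \<ge> 5 \<and>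
      C (j + 2) ! 1 = C 1 ! 1 \<and> continuant (tl (C (j + 2))) = x (j + 2) \<and>
      cf_value (C (j + 2)) = p / q + (\<Sum>i<Suc j. 1 / real_of_int (x (i + 2))) \<and>
      (s (j + 2) \<longleftrightarrow> C 1 ! 1 = 1 \<and> \<not> (j = 0 \<and> q = 2)) \<and>
      C (j + 3) = cf_step (s (j + 2)) (z (j + 3)) (C (j + 2))" for j
  proof (induction j)
    case 0
    have x2: "x 2 = q\<^sup>2 * z 2"
      using x_Suc[of 1] x1 by (simp add: numeral_2_eq_2)
    have C3: "C 3 = cf_step (s 2) (z 3) (C 2)"
      using assms(11)[of 2] last2 by (simp add: cf_step_def)
    show ?case
      using cf_step_correct[OF wf1 len1', of "z 2" "s 1"] z[of 2] C2 C3 last2 x2 den1 val1 len1'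
        cf_step_nth_1[of "C 1" "s 1" "z 2"]
      by (simp add: s_def del: add_2_eq_Suc')
  next
    case (Suc j)
    define c where "c = C (j + 2)"
    have c: "C (Suc j + 2) = cf_step (s (j + 2)) (z (j + 3)) c"
      using Suc c_def by (simp add: numeral_eq_Suc)
    have x: "x (Suc j + 2) = (x (j + 2))\<^sup>2 * z (j + 3)"
      using x_Suc[of "j + 2"] by (simp add: numeral_eq_Suc)
    have IH: "cf_wf c" "odd (length c)" "length c \<ge> 3" "length c \<noteq> 3" "c ! 1 = C 1 ! 1"
      "continuant (tl c) = x (j + 2)"
      "cf_value c = p / q + (\<Sum>i<Suc j. 1 / real_of_int (x (i + 2)))"
      using Suc by (auto simp: c_def)
    have s: "s (Suc j + 2) \<longleftrightarrow> C 1 ! 1 = 1"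
      using last_cf_step[OF IH(3), of "s (j + 2)" "z (j + 3)"] IH unfolding s_def c by auto
    have "C (Suc j + 3) = cf_step (s (Suc j + 2)) (z (Suc j + 3)) (C (Suc j + 2))"
      using assms(11)[of "j + 3"] s by (simp add: cf_step_def numeral_eq_Suc)
    moreover have "s (j + 2) \<longleftrightarrow> last c = 1"
      by (simp add: s_def c_def)
    note cf_step_correct[OF IH(1,3,2) z this, of "j + 3"]
    ultimately show ?case
      using s IH cf_step_nth_1[of c] unfolding c using x by (simp del: add_2_eq_Suc')
  qed
  have den: "continuant (tl (C N)) = x N \<and> cf_wf (C N) \<and> length (C N) \<ge> 2" if "N \<ge> 1" for N
  proof (cases "N = 1")
    case False
    then have "N \<ge> 2"
      using that by simp
    then obtain j where "N = j + 2"
      using le_Suc_ex add.commute by metis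
    then show ?thesis
      using inv[of j] by auto
  qed (use den1 x1 wf1 len1' in auto)
  have prefix: "\<exists>d. d \<noteq> [] \<and> C (Suc N) = C N @ d" if "N \<ge> 1" for N
  proof (cases "N = 1")
    case True
    then show ?thesis
      using C2 cf_step_prefix by (metis Suc_1)
  next
    case False
    then have "N \<ge> 2"
      using that by simp
    then obtain j where "N = j + 2"
      using le_Suc_ex add.commute by metis
    then have "C (Suc N) = cf_step (s N) (z (Suc N)) (C N)"
      using inv[of j] by (simp add: numeral_eq_Suc)
    then show ?thesis
      using cf_step_prefix by metis
  qed
  \<comment> \<open>This crude bound, from x^2 z >= 2 x for x >= 1 and z >= 2, serves twice: for
    comparison with a geometric series and for denominators tending to infinity.\<close>
  have x_ge: "x (Suc j) \<ge> 2 ^ j" for j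
  proof (induction j)
    case (Suc j)
    have "1 \<le> x (Suc j)"
      using Suc one_le_power[of "2::int" j] by linarith
    have "2 ^ Suc j \<le> x (Suc j) * 1 * 2"
      using Suc by simp
    also have "\<dots> \<le> x (Suc j) * x (Suc j) * z (Suc j + 1)"
      using \<open>1 \<le> x (Suc j)\<close> z[of "Suc j + 1"] by (intro mult_mono) auto
    finally show ?case
      using x_Suc[of "Suc j"] by (simp add: power2_eq_square)
  qed (use x1 q in simp)
  have x_ge': "real_of_int (x (Suc j)) \<ge> 2 ^ j" for j
    using x_ge[of j] by (metis of_int_le_iff of_int_numeral of_int_power)
  have sum: "summable (\<lambda>j. 1 / real_of_int (x (j + 2)))"
  proof (rule summable_comparison_test')
    show "summable (\<lambda>j. (1 / 2 :: real) ^ Suc j)"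
      by (subst summable_Suc_iff) (simp add: summable_geometric)
    show "norm (1 / real_of_int (x (j + 2))) \<le> (1 / 2) ^ Suc j" for j
    proof -
      have "real_of_int (x (j + 2)) \<ge> 2 ^ Suc j"
        using x_ge'[of "Suc j"] by simp
      then have "1 / real_of_int (x (j + 2)) \<le> 1 / 2 ^ Suc j"
        by (intro frac_le) auto
      moreover have "real_of_int (x (j + 2)) \<ge> 0"
        using \<open>real_of_int (x (j + 2)) \<ge> 2 ^ Suc j\<close> zero_le_power[of "2 :: real" "Suc j"] by linarith
      ultimately show ?thesis
        by (simp add: power_one_over)
    qed
  qed
  define \<alpha> where "\<alpha> = p / q + (\<Sum>j. 1 / real_of_int (x (j + 2)))"
  obtain b where b: "is_cf_limit C b"
    using cf_limit_exists prefix by blast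
  have "has_cf_expansion \<alpha> b"
  proof (rule cf_limit_expansion[OF b])
    have "real_of_int (x (Suc j)) \<ge> real j" for j
      using x_ge'[of j] of_nat_less_two_power[of j, where 'a = real] by linarith
    then have "filterlim (\<lambda>j. real_of_int (x (Suc j))) at_top sequentially"
      by (intro filterlim_at_top_mono[OF filterlim_real_sequentially]) auto
    then have "filterlim (\<lambda>j. real_of_int (continuant (tl (C (Suc j))))) at_top sequentially"
      using den by simp
    then show "filterlim (\<lambda>N. real_of_int (continuant (tl (C N)))) at_top sequentially"
      by (rule filterlim_sequentially_Suc[THEN iffD1])
    have "(\<lambda>j. \<Sum>i<j. 1 / real_of_int (x (i + 2))) \<longlonglongrightarrow> (\<Sum>j. 1 / real_of_int (x (j + 2)))"
      by (rule summable_LIMSEQ[OF sum])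
    then have "(\<lambda>j. p / q + (\<Sum>i<Suc j. 1 / real_of_int (x (i + 2)))) \<longlonglongrightarrow> \<alpha>"
      unfolding \<alpha>_def by (intro tendsto_add tendsto_const LIMSEQ_Suc)
    then have "(\<lambda>j. cf_value (C (j + 2))) \<longlonglongrightarrow> \<alpha>"
      using inv by simp
    then show "(\<lambda>N. cf_value (C N)) \<longlonglongrightarrow> \<alpha>"
      by (rule LIMSEQ_offset)
  qed (use den in auto)
  then show ?thesis
    using sum b \<alpha>_def by blast
qed

end
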